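(* The price of anarchy in financial network games with Credit Default Swap (CDS) contracts is $1$ when firms aim to maximize their equity. This holds for any payment scheme.
   Context: Financial network: firms $v_1,\dots,v_n$; $v_i$ has external assets $e_i\ge 0$. A debt contract creates a liability $l^0_{ij}\ge 0$ of $v_i$ to $v_j$, with $l^0_{ii}=0$. A Credit Default Swap is a conditional liability $(1-r_k)l^k_{ij}$ of $v_i$ to $v_j$, subject to the default of the reference entity $v_k$, where the recovery rate $r_k$ of a firm $v_k$ in default is the fraction of its total liabilities that it can fulfil (there is no such liability if $v_k$ is solvent, i.e. $r_k=1$). The total liability of $v_i$ to $v_j$ is $l_{ij}=l^0_{ij}+\sum_k(1-r_k)l^k_{ij}$, and $L_i=\sum_j l_{ij}$. There are no default costs. Clearing payments: a matrix $\mathbf P=(p_{ij})$ of payments from $v_i$ to $v_j$ with $p_{ii}=0$, $0\le p_{ij}\le l_{ij}$, and, for every $i$, $\sum_j p_{ij}=L_i$ if $L_i\le e_i+\sum_j p_{ji}$ ($v_i$ is solvent) and $\sum_j p_{ij}=e_i+\sum_j p_{ji}$ otherwise ($v_i$ is in default). They are proper if all the money circulating in the network originates from some firm with positive external assets; only proper clearing payments are considered. Strategies: the strategy $s_i(\cdot)$ of $v_i$ dictates how $v_i$ allocates its existing funds among its creditors, for any possible value these funds might have; a payment scheme specifies which strategies are allowed. The main scheme considered is that of priority-proportional strategies: a strategy is a complete ordering, allowing ties, of the creditors into priority classes; creditors of higher priority must be fully repaid before any payment is made to creditors of lower priority, and creditors in the same class are paid proportionally to their liabilities in that class. Clearing payments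 are consistent with a strategy profile $\mathbf s=(s_1,\dots,s_n)$ if each firm's payments are as dictated by its strategy. Equity: $E_i(\mathbf P)=\max\{0,\ e_i+\sum_j p_{ji}-L_i\}$. The utility of $v_i$ under a strategy profile is its equity, computed on the assumption that the maximal clearing payments consistent with the profile (those point-wise maximizing all payments) are realized. A strategy profile is a (pure) Nash equilibrium if no firm can increase its utility by deviating to another strategy. Social welfare: $SW(\mathbf P)=\sum_i E_i(\mathbf P)$; $OPT$ is the optimal social welfare. The price of anarchy of an instance is $\max_{\mathbf P}OPT/SW(\mathbf P)$ over the clearing payments $\mathbf P$ consistent with Nash equilibrium strategy profiles; the price of anarchy of a game is the maximum over its instances. *)

theory Defs
  imports Complex_Main "HOL-Library.Extended_Real"
begin

section \<open>Financial networks with debt contracts and credit default swaps\<close>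

text \<open>The firms are \<open>0, \<dots>, firms N - 1\<close>; every matrix below is only relevant on indices less
  than \<open>firms N\<close>. The contract \<open>cds N k i j\<close> is the nominal amount of the CDS of debtor \<open>i\<close>
  to creditor \<open>j\<close> with reference entity \<open>k\<close>.\<close>

record financial_network =
  firms :: nat
  assets :: "nat \<Rightarrow> real"
  debt :: "nat \<Rightarrow> nat \<Rightarrow> real"
  cds :: "nat \<Rightarrow> nat \<Rightarrow> nat \<Rightarrow> real"

definition well_formed :: "financial_network \<Rightarrow> bool" where
  "well_formed N \<longleftrightarrow>
     firms N \<ge> 1 \<and>
     (\<forall>i<firms N. assets N i \<ge> 0 \<and> debt N i i = 0) \<and>
     (\<forall>i<firms N. \<forall>j<firms N. debt N i j \<ge> 0) \<and>
     (\<forall>k<firms N. \<forall>i<firms N. \<forall>j<firms N. cds N k i j \<ge> 0)"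

type_synonym payments = "nat \<Rightarrow> nat \<Rightarrow> real"
type_synonym rates = "nat \<Rightarrow> real"

definition liability :: "financial_network \<Rightarrow> rates \<Rightarrow> nat \<Rightarrow> nat \<Rightarrow> real" where
  "liability N r i j = debt N i j + (\<Sum>k<firms N. (1 - r k) * cds N k i j)"

definition total_liability :: "financial_network \<Rightarrow> rates \<Rightarrow> nat \<Rightarrow> real" where
  "total_liability N r i = (\<Sum>j<firms N. liability N r i j)"

definition funds :: "financial_network \<Rightarrow> payments \<Rightarrow> nat \<Rightarrow> real" where
  "funds N P i = assets N i + (\<Sum>j<firms N. P j i)"

definition solvent :: "financial_network \<Rightarrow> rates \<Rightarrow> payments \<Rightarrow> nat \<Rightarrow> bool" where
  "solvent N r P i \<longleftrightarrow> total_liability N r i \<le> funds N P i"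

text \<open>Liabilities depend on recovery rates and recovery rates depend on liabilities, so the rates
  are carried along with the payments and are only required to be consistent with them; they
  need not be determined by the payments.\<close>

definition recovery_rates :: "financial_network \<Rightarrow> rates \<Rightarrow> payments \<Rightarrow> bool" where
  "recovery_rates N r P \<longleftrightarrow>
     (\<forall>i<firms N. r i = (if solvent N r P i then 1 else funds N P i / total_liability N r i))"

definition clearing :: "financial_network \<Rightarrow> rates \<Rightarrow> payments \<Rightarrow> bool" where
  "clearing N r P \<longleftrightarrow>
     recovery_rates N r P \<and>
     (\<forall>i<firms N. P i i = 0) \<and>
     (\<forall>i<firms N. \<forall>j<firms N. 0 \<le> P i j \<and> P i j \<le> liability N r i j) \<and>
     (\<forall>i<firms N. (\<Sum>j<firms N. P i j) =
        (if solvent N r P i then total_liability N r i else funds N P i))"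

text \<open>Money originates from firms with positive external assets: every firm making a positive
  payment is reached from such a firm along positive payments. By conservation of funds,
  this says that the payments decompose into walks of money starting at such firms.\<close>

definition pays :: "financial_network \<Rightarrow> payments \<Rightarrow> nat \<Rightarrow> nat \<Rightarrow> bool" where
  "pays N P i j \<longleftrightarrow> i < firms N \<and> j < firms N \<and> P i j > 0"

definition proper :: "financial_network \<Rightarrow> payments \<Rightarrow> bool" where
  "proper N P \<longleftrightarrow>
     (\<forall>i j. pays N P i j \<longrightarrow> (\<exists>k<firms N. assets N k > 0 \<and> (pays N P)\<^sup>*\<^sup>* k i))"

definition proper_clearing :: "financial_network \<Rightarrow> rates \<Rightarrow> payments \<Rightarrow> bool" where
  "proper_clearing N r P \<longleftrightarrow> clearing N r P \<and> proper N P"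

definition equity :: "financial_network \<Rightarrow> rates \<Rightarrow> payments \<Rightarrow> nat \<Rightarrow> real" where
  "equity N r P i = max 0 (funds N P i - total_liability N r i)"

definition social_welfare :: "financial_network \<Rightarrow> rates \<Rightarrow> payments \<Rightarrow> real" where
  "social_welfare N r P = (\<Sum>i<firms N. equity N r P i)"

definition optimal_welfare :: "financial_network \<Rightarrow> ereal" where
  "optimal_welfare N =
     Sup {ereal (social_welfare N r P) | r P. proper_clearing N r P}"


section \<open>Strategies and payment schemes\<close>

text \<open>If \<open>l j\<close> is a firm's liability to \<open>j\<close> and \<open>f\<close> its available funds, then \<open>s l f j\<close> is
  what the strategy \<open>s\<close> pays to \<open>j\<close>. Liabilities are an argument because those stemming from
  CDSs are not known in advance.\<close>

type_synonym strategy = "(nat \<Rightarrow> real) \<Rightarrow> real \<Rightarrow> nat \<Rightarrow> real"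
type_synonym profile = "nat \<Rightarrow> strategy"

definition allocates :: "nat \<Rightarrow> strategy \<Rightarrow> bool" where
  "allocates n s \<longleftrightarrow>
     (\<forall>l f. (\<forall>j<n. 0 \<le> l j) \<and> 0 \<le> f \<longrightarrow>
        (\<forall>j<n. 0 \<le> s l f j \<and> s l f j \<le> l j) \<and>
        (\<Sum>j<n. s l f j) = min f (\<Sum>j<n. l j))"

type_synonym scheme = "financial_network \<Rightarrow> nat \<Rightarrow> strategy set"

definition payment_scheme :: "scheme \<Rightarrow> bool" where
  "payment_scheme S \<longleftrightarrow>
     (\<forall>N i. well_formed N \<and> i < firms N \<longrightarrow>
        S N i \<noteq> {} \<and> (\<forall>s\<in>S N i. allocates (firms N) s))"

text \<open>A complete ordering with ties is given by a rank function \<open>c\<close>: creditors with equal ranks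
  form a class, and smaller ranks mean higher priority. Division by zero is zero, so creditors
  in a class with no liabilities are paid nothing.\<close>

definition priority_proportional_strategy :: "nat \<Rightarrow> (nat \<Rightarrow> nat) \<Rightarrow> strategy" where
  "priority_proportional_strategy n c l f j =
     (let higher = (\<Sum>m | m < n \<and> c m < c j. l m);
          same = (\<Sum>m | m < n \<and> c m = c j. l m)
      in l j * min 1 (max 0 (f - higher) / same))"

definition priority_proportional :: scheme where
  "priority_proportional N i = range (priority_proportional_strategy (firms N))"

lemma priority_proportional_prefix:
  assumes "\<forall>j<n. 0 \<le> l j" "0 \<le> f"
  shows "(\<Sum>j | j < n \<and> c j < x. priority_proportional_strategy n c l f j) =
         min f (\<Sum>j | j < n \<and> c j < x. l j)"
proof (induction x)
  case 0
  then show ?case using assms by simp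
next
  case (Suc x)
  let ?A = "{j. j < n \<and> c j < x}" and ?B = "{j. j < n \<and> c j = x}"
  have split: "{j. j < n \<and> c j < Suc x} = ?A \<union> ?B" by auto
  have union: "sum g {j. j < n \<and> c j < Suc x} = sum g ?A + sum g ?B" for g :: "nat \<Rightarrow> real"
    unfolding split by (rule sum.union_disjoint) auto
  have "sum (priority_proportional_strategy n c l f) ?B =
        (\<Sum>j\<in>?B. l j * min 1 (max 0 (f - sum l ?A) / sum l ?B))"
    by (rule sum.cong) (auto simp: priority_proportional_strategy_def)
  also have "\<dots> = sum l ?B * min 1 (max 0 (f - sum l ?A) / sum l ?B)"
    by (simp add: sum_distrib_right)
  also have "\<dots> = min f (sum l ?A + sum l ?B) - min f (sum l ?A)"
  proof -
    have "sum l ?B \<ge> 0" using assms by (intro sum_nonneg) auto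
    then show ?thesis
      by (cases "sum l ?B = 0") (auto simp: min_def max_def field_simps)
  qed
  finally show ?case using Suc by (simp add: union)
qed

lemma allocates_priority_proportional:
  "allocates n (priority_proportional_strategy n c)"
  unfolding allocates_def
proof (intro allI impI conjI)
  fix l :: "nat \<Rightarrow> real" and f :: real
  assume *: "(\<forall>j<n. 0 \<le> l j) \<and> 0 \<le> f"
  define y where "y = Suc (\<Sum>j<n. c j)"
  have "c j < y" if "j < n" for j
    using member_le_sum[of j "{..<n}" c] that by (simp add: y_def)
  then have "{j. j < n \<and> c j < y} = {..<n}" by auto
  then show "(\<Sum>j<n. priority_proportional_strategy n c l f j) = min f (\<Sum>j<n. l j)"
    using priority_proportional_prefix[of n l f c y] * by simp
next
  fix l :: "nat \<Rightarrow> real" and f :: real and j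
  assume *: "(\<forall>j<n. 0 \<le> l j) \<and> 0 \<le> f" and j: "j < n"
  have "0 \<le> (\<Sum>m | m < n \<and> c m = c j. l m)" using * by (intro sum_nonneg) auto
  then show "0 \<le> priority_proportional_strategy n c l f j"
    using * j by (simp add: priority_proportional_strategy_def)
next
  fix l :: "nat \<Rightarrow> real" and f :: real and j
  assume *: "(\<forall>j<n. 0 \<le> l j) \<and> 0 \<le> f" and j: "j < n"
  then show "priority_proportional_strategy n c l f j \<le> l j"
    by (simp add: priority_proportional_strategy_def mult_left_le)
qed

lemma payment_scheme_priority_proportional: "payment_scheme priority_proportional"
  by (auto simp: payment_scheme_def priority_proportional_def allocates_priority_proportional)


section \<open>Equilibria and the price of anarchy\<close>

definition consistent :: "financial_network \<Rightarrow> profile \<Rightarrow> rates \<Rightarrow> payments \<Rightarrow> bool" where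
  "consistent N s r P \<longleftrightarrow>
     (\<forall>i<firms N. \<forall>j<firms N. P i j = s i (liability N r i) (funds N P i) j)"

definition maximal_clearing :: "financial_network \<Rightarrow> profile \<Rightarrow> rates \<Rightarrow> payments \<Rightarrow> bool" where
  "maximal_clearing N s r P \<longleftrightarrow>
     proper_clearing N r P \<and> consistent N s r P \<and>
     (\<forall>r' P'. proper_clearing N r' P' \<and> consistent N s r' P' \<longrightarrow>
        (\<forall>i<firms N. \<forall>j<firms N. P' i j \<le> P i j))"

text \<open>Utility is a relation, since with CDSs a profile may fail to have maximal clearing payments
  and then has no utility. An equilibrium must have utilities; a deviation after which there
  is no utility does not count as an improvement.\<close>

definition has_utility :: "financial_network \<Rightarrow> profile \<Rightarrow> nat \<Rightarrow> real \<Rightarrow> bool" where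
  "has_utility N s i u \<longleftrightarrow> (\<exists>r P. maximal_clearing N s r P \<and> u = equity N r P i)"

definition nash_equilibrium :: "scheme \<Rightarrow> financial_network \<Rightarrow> profile \<Rightarrow> bool" where
  "nash_equilibrium S N s \<longleftrightarrow>
     (\<forall>i<firms N. s i \<in> S N i) \<and>
     (\<forall>i<firms N. \<exists>u. has_utility N s i u) \<and>
     (\<forall>i<firms N. \<forall>t\<in>S N i. \<forall>u u'.
        has_utility N s i u \<and> has_utility N (s(i := t)) i u' \<longrightarrow> u' \<le> u)"

text \<open>The ratio 0/0 counts as 1 (nothing is lost); a positive optimum against zero welfare gives
  \<open>\<infinity>\<close>, which is already the convention of the division on \<open>ereal\<close>.\<close>

definition welfare_ratio :: "ereal \<Rightarrow> ereal \<Rightarrow> ereal" where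
  "welfare_ratio opt w = (if opt = 0 \<and> w = 0 then 1 else opt / w)"

definition instance_price_of_anarchy :: "scheme \<Rightarrow> financial_network \<Rightarrow> ereal" where
  "instance_price_of_anarchy S N =
     Sup {welfare_ratio (optimal_welfare N) (ereal (social_welfare N r P)) | s r P.
            nash_equilibrium S N s \<and> proper_clearing N r P \<and> consistent N s r P}"

text \<open>Only instances possessing an equilibrium have a price of anarchy. The supremum over no
  instances would be \<open>-\<infinity>\<close>.\<close>

definition price_of_anarchy :: "scheme \<Rightarrow> ereal" where
  "price_of_anarchy S =
     Sup {instance_price_of_anarchy S N | N. well_formed N \<and> (\<exists>s. nash_equilibrium S N s)}"

end

(* Every firm either pays all its liabilities and keeps the rest as equity, or pays out all its
   funds and has equity 0, so its equity is its funds minus its payments. Internal payments cancel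
   in the sum over all firms: under any clearing payments, social welfare is the total of the
   external assets. *)
theory Submission
  imports Defs
begin

lemma equity_clearing:
  assumes "clearing N r P" "i < firms N"
  shows "equity N r P i = funds N P i - (\<Sum>j<firms N. P i j)"
  using assms by (auto simp: clearing_def equity_def solvent_def)

lemma social_welfare_clearing:
  assumes "clearing N r P"
  shows "social_welfare N r P = (\<Sum>i<firms N. assets N i)"
proof -
  have "social_welfare N r P = (\<Sum>i<firms N. funds N P i - (\<Sum>j<firms N. P i j))"
    unfolding social_welfare_def by (intro sum.cong) (auto simp: equity_clearing[OF assms])
  also have "\<dots> = (\<Sum>i<firms N. assets N i)
      + (\<Sum>i<firms N. \<Sum>j<firms N. P j i) - (\<Sum>i<firms N. \<Sum>j<firms N. P i j)"
    by (simp add: funds_def sum.distrib sum_subtractf)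
  also have "(\<Sum>i<firms N. \<Sum>j<firms N. P j i) = (\<Sum>i<firms N. \<Sum>j<firms N. P i j)"
    by (rule sum.swap)
  finally show ?thesis by simp
qed

text \<open>All proper clearing payments have the same welfare, so the supremum is over at most one
  value. The assumption makes that set nonempty, as the empty supremum would be minus
  infinity.\<close>

lemma optimal_welfare_eq:
  assumes "proper_clearing N r P"
  shows "optimal_welfare N = ereal (\<Sum>i<firms N. assets N i)"
proof -
  have "{ereal (social_welfare N r P) | r P. proper_clearing N r P}
      = {ereal (\<Sum>i<firms N. assets N i)}"
    using assms social_welfare_clearing unfolding proper_clearing_def by (auto; metis)
  then show ?thesis by (simp add: optimal_welfare_def)
qed

text \<open>Optimum and welfare are the same finite number; if it is 0, the 0/0 convention gives the
  ratio 1.\<close>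

lemma welfare_ratio_clearing:
  assumes "proper_clearing N r P"
  shows "welfare_ratio (optimal_welfare N) (ereal (social_welfare N r P)) = 1"
  using assms optimal_welfare_eq[OF assms]
  by (simp add: proper_clearing_def social_welfare_clearing welfare_ratio_def
      zero_ereal_def one_ereal_def)

lemma instance_price_of_anarchy_eq_1:
  assumes "firms N \<ge> 1" "nash_equilibrium S N s"
  shows "instance_price_of_anarchy S N = 1"
proof -
  \<comment> \<open>An equilibrium must have utilities. Firm 0 exists, and its utility yields
    consistent proper clearing payments, so the set of ratios is nonempty.\<close>
  obtain u where "has_utility N s 0 u"
    using assms unfolding nash_equilibrium_def by force
  then obtain r P where "proper_clearing N r P" "consistent N s r P"
    unfolding has_utility_def maximal_clearing_def by blast
  then have "{welfare_ratio (optimal_welfare N) (ereal (social_welfare N r P)) | s r P.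
      nash_equilibrium S N s \<and> proper_clearing N r P \<and> consistent N s r P} = {1}"
    using assms(2) welfare_ratio_clearing by (auto simp: set_eq_iff) metis
  then show ?thesis by (simp add: instance_price_of_anarchy_def)
qed

text \<open>A witness that every payment scheme has an instance with an equilibrium, so that the
  outer supremum is not empty.\<close>

definition trivial_network :: financial_network where
  "trivial_network = \<lparr>firms = 1, assets = \<lambda>_. 0, debt = \<lambda>_ _. 0, cds = \<lambda>_ _ _. 0\<rparr>"

lemma trivial_network_sel [simp]:
  "firms trivial_network = 1" "assets trivial_network i = 0"
  "debt trivial_network i j = 0" "cds trivial_network k i j = 0"
  by (simp_all add: trivial_network_def)

lemma well_formed_trivial_network: "well_formed trivial_network"
  by (simp add: well_formed_def)

lemma trivial_network_liability [simp]:
  "liability trivial_network r i j = 0" "total_liability trivial_network r i = 0"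
  by (simp_all add: liability_def total_liability_def)

lemma maximal_clearing_trivial_network:
  assumes "allocates 1 (s 0)"
  shows "maximal_clearing trivial_network s (\<lambda>_. 1) (\<lambda>_ _. 0)"
proof -
  \<comment> \<open>An allocation lies between 0 and the liability, here 0; this makes zero payments
    consistent. They are maximal because liabilities bound all clearing payments.\<close>
  have "s 0 (\<lambda>_. 0) 0 0 = 0"
    using assms unfolding allocates_def by (force dest: spec[of _ "\<lambda>_. 0"] spec[of _ 0])
  moreover have "liability trivial_network (\<lambda>_. 1) 0 = (\<lambda>_. 0)" by auto
  ultimately show ?thesis
    by (auto simp: maximal_clearing_def proper_clearing_def clearing_def proper_def pays_def
        recovery_rates_def solvent_def funds_def consistent_def)
qed

lemma nash_equilibrium_trivial_network:
  assumes "payment_scheme S"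
  obtains s where "nash_equilibrium S trivial_network s"
proof -
  from assms have S: "S trivial_network 0 \<noteq> {}" "\<forall>t\<in>S trivial_network 0. allocates 1 t"
    using well_formed_trivial_network unfolding payment_scheme_def by force+
  then obtain t where t: "t \<in> S trivial_network 0" "allocates 1 t" by blast
  \<comment> \<open>With no assets and no payment to itself, the only firm has equity 0 under every
    profile, so no deviation can help.\<close>
  have utility: "u = 0" if "has_utility trivial_network s 0 u" for s u
    using that by (auto simp: has_utility_def maximal_clearing_def proper_clearing_def
        clearing_def equity_def funds_def)
  have "\<exists>u. has_utility trivial_network (\<lambda>_. t) 0 u"
    using maximal_clearing_trivial_network[of "\<lambda>_. t"] t unfolding has_utility_def by blast
  then have "nash_equilibrium S trivial_network (\<lambda>_. t)"
    using t by (auto simp: nash_equilibrium_def dest!: utility)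
  then show thesis by (rule that)
qed

lemma price_of_anarchy_eq_1:
  assumes "payment_scheme S"
  shows "price_of_anarchy S = 1"
proof -
  obtain s where "nash_equilibrium S trivial_network s"
    using nash_equilibrium_trivial_network[OF assms] .
  then have "\<exists>N. well_formed N \<and> (\<exists>s. nash_equilibrium S N s)"
    using well_formed_trivial_network by blast
  moreover have "instance_price_of_anarchy S N = 1"
    if "well_formed N" "nash_equilibrium S N s" for N s
    using that instance_price_of_anarchy_eq_1 by (auto simp: well_formed_def)
  ultimately have "{instance_price_of_anarchy S N | N.
      well_formed N \<and> (\<exists>s. nash_equilibrium S N s)} = {1}"
    by (auto simp: set_eq_iff) metis
  then show ?thesis by (simp add: price_of_anarchy_def)
qed

theorem corollary13:
  shows "price_of_anarchy priority_proportional = 1 \<and>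
         (\<forall>S. payment_scheme S \<longrightarrow> price_of_anarchy S = 1)"
  using price_of_anarchy_eq_1 payment_scheme_priority_proportional by blast

end
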